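(* Let $(V^+,V^-)$ be a linear Jordan pair over $\mathbb K$ and fix $a\in V^-$. Let $$\mathcal U_a:=\{x\in V^+\mid B(x,-a)\in\mathrm{GL}(V^+)\}$$ be the set of elements $x\in V^+$ such that $(x,-a)$ is quasi-invertible. Then, for all $x\in\mathcal U_a$, the set $\mathcal U_a$ is stable under the transformations $$\mathcal Q(x):=\tau_{2x+Q(x)a}\circ B(x,-a),\qquad \sigma_0:=-\tilde\tau_{-a}=\tilde\tau_a\circ(-\mathrm{id}),$$ and $(\mathcal U_a,\mathcal Q,\sigma_0)$ is a reflection space with base point $0$ (that is, the maps $\sigma_x:=\mathcal Q(x)\circ\sigma_0$, $x\in\mathcal U_a$, define a reflection space structure $\mu(x,y)=\sigma_x(y)$ on $\mathcal U_a$ whose symmetry at $0$ is $\sigma_0$ and whose quadratic map with respect to $0$ is $\mathcal Q$). Moreover, for every $x\in\mathcal U_a$, the algebraic differential $D\sigma_x(x)$ of the symmetry $\sigma_x$ at $x$, defined by $\sigma_x(x+\varepsilon v)=\sigma_x(x)+\varepsilon D\sigma_x(x)v$, equals $-\mathrm{id}_{V^+}$, and thus $\mathcal U_a$ is a symmetric space.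
   Context: $\mathbb K$ is a commutative ring in which $2$ and $3$ are invertible. A linear Jordan pair over $\mathbb K$ is a pair of $\mathbb K$-modules $(V^+,V^-)$ with trilinear maps $T^\pm:V^\pm\times V^\mp\times V^\pm\to V^\pm$ such that $T^\pm(x,y,z)=T^\pm(z,y,x)$ and $$T^\pm(u,v,T^\pm(x,y,z))=T^\pm(T^\pm(u,v,x),y,z)-T^\pm(x,T^\mp(v,u,y),z)+T^\pm(x,y,T^\pm(u,v,z)).$$ Write $T(x,y):=T^\pm(x,y,\cdot)$, $Q(x):=Q^\pm(x):=\tfrac12T^\pm(x,\cdot,x):V^\mp\to V^\pm$. For $x\in V^\pm$, $y\in V^\mp$ the Bergman operator is $B(x,y)=\mathrm{id}-T(x,y)+Q(x)Q(y)\in\mathrm{End}(V^\pm)$; the pair $(x,y)$ is quasi-invertible if $B(x,y)$ is invertible, and then the quasi-inverse is $\tilde\tau_y(x)=B(x,y)^{-1}(x-Q(x)y)$. $\tau_v$ denotes translation $z\mapsto z+v$. A reflection space is a set $M$ with maps $\sigma_x:M\to M$ ($x\in M$) such that (S1) $\sigma_x(x)=x$, (S2) $\sigma_x\circ\sigma_x=\mathrm{id}_M$, (S3) $\sigma_x\sigma_y\sigma_x=\sigma_{\sigma_x(y)}$. For a base point $o$, its quadratic map is $\mathcal Q(x)=\sigma_x\circ\sigma_o$. It is called a symmetric space (in the algebraic sense) if moreover (S4) the tangent map of each $\sigma_x$ at $x$ is $-\mathrm{id}$. The algebraic differential is defined by scalar extension by dual numbers $\mathbb K[\varepsilon]=\mathbb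 K\oplus\varepsilon\mathbb K$, $\varepsilon^2=0$: the formulas for $\mathcal Q(x)$, $\sigma_0$, $\sigma_x$ are evaluated in the Jordan pair $(V^+\otimes_{\mathbb K}\mathbb K[\varepsilon],V^-\otimes_{\mathbb K}\mathbb K[\varepsilon])$ over $\mathbb K[\varepsilon]$, at points $x+\varepsilon v$ with $x\in\mathcal U_a$, $v\in V^+$. *)

theory Defs
  imports Complex_Main
begin

subsection \<open>Linear Jordan pairs\<close>

text \<open>
  The scalars form a type of class \<^class>\<open>comm_ring_1\<close>; the two modules are types with
  an explicit scalar multiplication. Notions for the upper sign are defined for \<open>V\<close>; the lower
  sign is obtained by applying them to the opposite pair.
\<close>

record ('k, 'p, 'm) jordan_pair_data =
  scale_plus :: "'k \<Rightarrow> 'p \<Rightarrow> 'p"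
  scale_minus :: "'k \<Rightarrow> 'm \<Rightarrow> 'm"
  triple_plus :: "'p \<Rightarrow> 'm \<Rightarrow> 'p \<Rightarrow> 'p"
  triple_minus :: "'m \<Rightarrow> 'p \<Rightarrow> 'm \<Rightarrow> 'm"

definition opposite :: "('k, 'p, 'm) jordan_pair_data \<Rightarrow> ('k, 'm, 'p) jordan_pair_data" where
  "opposite V = \<lparr>scale_plus = scale_minus V, scale_minus = scale_plus V,
                 triple_plus = triple_minus V, triple_minus = triple_plus V\<rparr>"

definition trilinear ::
  "('k::comm_ring_1, 'p::ab_group_add, 'm::ab_group_add) jordan_pair_data \<Rightarrow> bool" where
  "trilinear V \<longleftrightarrow>
     (\<forall>y z. module_hom (scale_plus V) (scale_plus V) (\<lambda>x. triple_plus V x y z)) \<and>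
     (\<forall>x z. module_hom (scale_minus V) (scale_plus V) (\<lambda>y. triple_plus V x y z)) \<and>
     (\<forall>x y. module_hom (scale_plus V) (scale_plus V) (\<lambda>z. triple_plus V x y z))"

definition jordan_identities ::
  "('k::comm_ring_1, 'p::ab_group_add, 'm::ab_group_add) jordan_pair_data \<Rightarrow> bool" where
  "jordan_identities V \<longleftrightarrow>
     (\<forall>x y z. triple_plus V x y z = triple_plus V z y x) \<and>
     (\<forall>u v x y z. triple_plus V u v (triple_plus V x y z) =
        triple_plus V (triple_plus V u v x) y z
        - triple_plus V x (triple_minus V v u y) z
        + triple_plus V x y (triple_plus V u v z))"

definition linear_jordan_pair ::
  "('k::comm_ring_1, 'p::ab_group_add, 'm::ab_group_add) jordan_pair_data \<Rightarrow> bool" where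
  "linear_jordan_pair V \<longleftrightarrow>
     module (scale_plus V) \<and> module (scale_minus V) \<and>
     trilinear V \<and> trilinear (opposite V) \<and>
     jordan_identities V \<and> jordan_identities (opposite V)"


subsection \<open>Bergman operator and quasi-inverse\<close>

text \<open>The unique inverse of \<open>2\<close>, if \<open>2\<close> is invertible in the ring.\<close>

definition half :: "'k::comm_ring_1" where
  "half = (THE h. 2 * h = 1)"

definition Qop ::
  "('k::comm_ring_1, 'p::ab_group_add, 'm::ab_group_add) jordan_pair_data \<Rightarrow> 'p \<Rightarrow> 'm \<Rightarrow> 'p" where
  "Qop V x y = scale_plus V half (triple_plus V x y x)"

definition bergman ::
  "('k::comm_ring_1, 'p::ab_group_add, 'm::ab_group_add) jordan_pair_data
     \<Rightarrow> 'p \<Rightarrow> 'm \<Rightarrow> 'p \<Rightarrow> 'p" where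
  "bergman V x y = (\<lambda>z. z - triple_plus V x y z + Qop V x (Qop (opposite V) y z))"

definition general_linear :: "('k::comm_ring_1 \<Rightarrow> 'v::ab_group_add \<Rightarrow> 'v) \<Rightarrow> ('v \<Rightarrow> 'v) set" where
  "general_linear s = {f. module_hom s s f \<and> bij f}"

definition quasi_invertible ::
  "('k::comm_ring_1, 'p::ab_group_add, 'm::ab_group_add) jordan_pair_data
     \<Rightarrow> 'p \<Rightarrow> 'm \<Rightarrow> bool" where
  "quasi_invertible V x y \<longleftrightarrow> bergman V x y \<in> general_linear (scale_plus V)"

text \<open>\<open>quasi_inverse V y x\<close> is \<open>\<tau>~\<^sub>y(x)\<close>; it is meaningful only if \<open>quasi_invertible V x y\<close>.\<close>

definition quasi_inverse ::
  "('k::comm_ring_1, 'p::ab_group_add, 'm::ab_group_add) jordan_pair_data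
     \<Rightarrow> 'm \<Rightarrow> 'p \<Rightarrow> 'p" where
  "quasi_inverse V y x = inv (bergman V x y) (x - Qop V x y)"

definition translation :: "'v::ab_group_add \<Rightarrow> 'v \<Rightarrow> 'v" where
  "translation v z = z + v"


subsection \<open>The set \<open>U\<^sub>a\<close> and its transformations\<close>

definition U_set ::
  "('k::comm_ring_1, 'p::ab_group_add, 'm::ab_group_add) jordan_pair_data \<Rightarrow> 'm \<Rightarrow> 'p set" where
  "U_set V a = {x. quasi_invertible V x (- a)}"

definition U_quad ::
  "('k::comm_ring_1, 'p::ab_group_add, 'm::ab_group_add) jordan_pair_data
     \<Rightarrow> 'm \<Rightarrow> 'p \<Rightarrow> 'p \<Rightarrow> 'p" where
  "U_quad V a x = translation (scale_plus V 2 x + Qop V x a) \<circ> bergman V x (- a)"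

definition U_sym0 ::
  "('k::comm_ring_1, 'p::ab_group_add, 'm::ab_group_add) jordan_pair_data
     \<Rightarrow> 'm \<Rightarrow> 'p \<Rightarrow> 'p" where
  "U_sym0 V a z = - quasi_inverse V (- a) z"

definition U_sym ::
  "('k::comm_ring_1, 'p::ab_group_add, 'm::ab_group_add) jordan_pair_data
     \<Rightarrow> 'm \<Rightarrow> 'p \<Rightarrow> 'p \<Rightarrow> 'p" where
  "U_sym V a x = U_quad V a x \<circ> U_sym0 V a"


subsection \<open>Reflection spaces\<close>

definition reflection_space :: "'v set \<Rightarrow> ('v \<Rightarrow> 'v \<Rightarrow> 'v) \<Rightarrow> bool" where
  "reflection_space M \<sigma> \<longleftrightarrow>
     (\<forall>x\<in>M. \<forall>y\<in>M. \<sigma> x y \<in> M) \<and>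
     (\<forall>x\<in>M. \<sigma> x x = x) \<and>
     (\<forall>x\<in>M. \<forall>y\<in>M. \<sigma> x (\<sigma> x y) = y) \<and>
     (\<forall>x\<in>M. \<forall>y\<in>M. \<forall>z\<in>M. \<sigma> x (\<sigma> y (\<sigma> x z)) = \<sigma> (\<sigma> x y) z)"

definition quadratic_map :: "('v \<Rightarrow> 'v \<Rightarrow> 'v) \<Rightarrow> 'v \<Rightarrow> 'v \<Rightarrow> 'v \<Rightarrow> 'v" where
  "quadratic_map \<sigma> b x = \<sigma> x \<circ> \<sigma> b"


subsection \<open>Scalar extension by dual numbers\<close>

text \<open>
  \<open>Dual x v\<close> stands for \<open>x + \<epsilon> v\<close>. The type \<open>'k dualnum\<close> is the ring \<open>K[\<epsilon>]\<close>, and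
  \<open>V \<otimes> K[\<epsilon>]\<close> is identified with \<open>V \<oplus> \<epsilon> V\<close>, i.e. with \<open>'v dualnum\<close>.
\<close>

datatype 'a dualnum = Dual 'a 'a

instantiation dualnum :: (ab_group_add) ab_group_add
begin

definition "0 = Dual 0 0"

fun plus_dualnum where
  "Dual x u + Dual y v = Dual (x + y) (u + v)"

fun minus_dualnum where
  "Dual x u - Dual y v = Dual (x - y) (u - v)"

fun uminus_dualnum where
  "- Dual x u = Dual (- x) (- u)"

instance
proof
  fix p q r :: "'a dualnum"
  show "p + q + r = p + (q + r)"
    by (cases p; cases q; cases r) (simp add: add.assoc)
  show "p + q = q + p"
    by (cases p; cases q) (simp add: add.commute)
  show "0 + p = p"
    by (cases p) (simp add: zero_dualnum_def)
  show "- p + p = 0"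
    by (cases p) (simp add: zero_dualnum_def)
  show "p - q = p + - q"
    by (cases p; cases q) simp
qed

end

instantiation dualnum :: (comm_ring_1) comm_ring_1
begin

definition "1 = Dual 1 0"

fun times_dualnum where
  "Dual x u * Dual y v = Dual (x * y) (x * v + u * y)"

instance
proof
  fix p q r :: "'a dualnum"
  show "p * q * r = p * (q * r)"
    by (cases p; cases q; cases r) (simp add: algebra_simps)
  show "p * q = q * p"
    by (cases p; cases q) (simp add: algebra_simps)
  show "1 * p = p"
    by (cases p) (simp add: one_dualnum_def)
  show "(p + q) * r = p * r + q * r"
    by (cases p; cases q; cases r) (simp add: algebra_simps)
  show "(0 :: 'a dualnum) \<noteq> 1"
    by (simp add: zero_dualnum_def one_dualnum_def)
qed

end

fun scale_dual :: "('k \<Rightarrow> 'v \<Rightarrow> 'v::ab_group_add) \<Rightarrow> 'k dualnum \<Rightarrow> 'v dualnum \<Rightarrow> 'v dualnum" where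
  "scale_dual s (Dual r t) (Dual x u) = Dual (s r x) (s r u + s t x)"

fun triple_dual ::
  "('p \<Rightarrow> 'm \<Rightarrow> 'p \<Rightarrow> 'p::ab_group_add) \<Rightarrow> 'p dualnum \<Rightarrow> 'm dualnum \<Rightarrow> 'p dualnum \<Rightarrow> 'p dualnum" where
  "triple_dual T (Dual x u) (Dual y v) (Dual z w) =
     Dual (T x y z) (T u y z + T x v z + T x y w)"

definition dual_extension ::
  "('k, 'p::ab_group_add, 'm::ab_group_add) jordan_pair_data
     \<Rightarrow> ('k dualnum, 'p dualnum, 'm dualnum) jordan_pair_data" where
  "dual_extension V = \<lparr>scale_plus = scale_dual (scale_plus V),
                       scale_minus = scale_dual (scale_minus V),
                       triple_plus = triple_dual (triple_plus V),
                       triple_minus = triple_dual (triple_minus V)\<rparr>"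

lemma opposite_dual_extension: "opposite (dual_extension V) = dual_extension (opposite V)"
  by (simp add: opposite_def dual_extension_def)

lemma module_scale_dual:
  assumes "module s"
  shows "module (scale_dual s)"
proof -
  interpret module s by fact
  show ?thesis
  proof
    fix a b :: "'a dualnum" and x y :: "'b dualnum"
    show "scale_dual s a (x + y) = scale_dual s a x + scale_dual s a y"
      by (cases a; cases x; cases y) (simp add: scale_right_distrib algebra_simps)
    show "scale_dual s (a + b) x = scale_dual s a x + scale_dual s b x"
      by (cases a; cases b; cases x) (simp add: scale_left_distrib algebra_simps)
    show "scale_dual s a (scale_dual s b x) = scale_dual s (a * b) x"
      by (cases a; cases b; cases x)
        (simp add: scale_right_distrib scale_left_distrib algebra_simps)
    show "scale_dual s 1 x = x"
      by (cases x) (simp add: one_dualnum_def)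
  qed
qed

lemma trilinearD:
  assumes "trilinear V"
  shows "triple_plus V (x + x') y z = triple_plus V x y z + triple_plus V x' y z"
    and "triple_plus V (scale_plus V r x) y z = scale_plus V r (triple_plus V x y z)"
    and "triple_plus V x (y + y') z = triple_plus V x y z + triple_plus V x y' z"
    and "triple_plus V x (scale_minus V r y) z = scale_plus V r (triple_plus V x y z)"
    and "triple_plus V x y (z + z') = triple_plus V x y z + triple_plus V x y z'"
    and "triple_plus V x y (scale_plus V r z) = scale_plus V r (triple_plus V x y z)"
  using assms unfolding trilinear_def module_hom_iff by blast+

lemma trilinear_dual_extension:
  assumes "trilinear V" "module (scale_plus V)" "module (scale_minus V)"
  shows "trilinear (dual_extension V)"
proof -
  let ?T = "triple_plus V" and ?sp = "scale_plus V" and ?sm = "scale_minus V"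
  note lin = trilinearD[OF assms(1)]
  note m = module_scale_dual[OF assms(2)] module_scale_dual[OF assms(3)]
  have d: "?sp r (x + y) = ?sp r x + ?sp r y" for r x y
    using assms(2) by (rule module.scale_right_distrib)
  show ?thesis
    unfolding trilinear_def dual_extension_def jordan_pair_data.simps
      module_hom_def module_hom_axioms_def
  proof (intro conjI allI m)
    fix x x' z z' :: "'b dualnum" and y y' :: "'c dualnum" and r :: "'a dualnum"
    show "triple_dual ?T (x + x') y z = triple_dual ?T x y z + triple_dual ?T x' y z"
      by (cases x; cases x'; cases y; cases z) (simp add: lin algebra_simps)
    show "triple_dual ?T (scale_dual ?sp r x) y z = scale_dual ?sp r (triple_dual ?T x y z)"
      by (cases r; cases x; cases y; cases z) (simp add: lin d algebra_simps)
    show "triple_dual ?T x (y + y') z = triple_dual ?T x y z + triple_dual ?T x y' z"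
      by (cases x; cases y; cases y'; cases z) (simp add: lin algebra_simps)
    show "triple_dual ?T x (scale_dual ?sm r y) z = scale_dual ?sp r (triple_dual ?T x y z)"
      by (cases r; cases x; cases y; cases z) (simp add: lin d algebra_simps)
    show "triple_dual ?T x y (z + z') = triple_dual ?T x y z + triple_dual ?T x y z'"
      by (cases x; cases y; cases z; cases z') (simp add: lin algebra_simps)
    show "triple_dual ?T x y (scale_dual ?sp r z) = scale_dual ?sp r (triple_dual ?T x y z)"
      by (cases r; cases x; cases y; cases z) (simp add: lin d algebra_simps)
  qed
qed

lemma jordan_identities_dual_extension:
  assumes "trilinear V" "jordan_identities V"
  shows "jordan_identities (dual_extension V)"
proof -
  let ?T = "triple_plus V" and ?S = "triple_minus V"
  note lin = trilinearD[OF assms(1)]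
  have c: "?T x y z = ?T z y x" for x y z
    using assms(2) unfolding jordan_identities_def by blast
  have j: "?T u v (?T x y z) = ?T (?T u v x) y z - ?T x (?S v u y) z + ?T x y (?T u v z)"
    for u v x y z
    using assms(2) unfolding jordan_identities_def by blast
  show ?thesis
    unfolding jordan_identities_def dual_extension_def jordan_pair_data.simps
  proof (intro conjI allI)
    fix u x z :: "'b dualnum" and v y :: "'c dualnum"
    obtain x1 x2 y1 y2 z1 z2 where [simp]: "x = Dual x1 x2" "y = Dual y1 y2" "z = Dual z1 z2"
      by (metis dualnum.exhaust)
    obtain u1 u2 v1 v2 where [simp]: "u = Dual u1 u2" "v = Dual v1 v2"
      by (metis dualnum.exhaust)
    show "triple_dual ?T x y z = triple_dual ?T z y x"
      using c[of x1 y1 z1] c[of x2 y1 z1] c[of x1 y2 z1] c[of x1 y1 z2]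
      by (simp add: algebra_simps)
    show "triple_dual ?T u v (triple_dual ?T x y z) =
        triple_dual ?T (triple_dual ?T u v x) y z
        - triple_dual ?T x (triple_dual ?S v u y) z
        + triple_dual ?T x y (triple_dual ?T u v z)"
      by (simp add: lin j[of u1 v1 x1 y1 z1] j[of u2 v1 x1 y1 z1] j[of u1 v2 x1 y1 z1]
          j[of u1 v1 x2 y1 z1] j[of u1 v1 x1 y2 z1] j[of u1 v1 x1 y1 z2])
  qed
qed

theorem linear_jordan_pair_dual_extension:
  assumes "linear_jordan_pair V"
  shows "linear_jordan_pair (dual_extension V)"
proof -
  have "module (scale_plus (dual_extension V))" "module (scale_minus (dual_extension V))"
    using assms by (simp_all add: linear_jordan_pair_def dual_extension_def module_scale_dual)
  moreover have "module (scale_plus (opposite V))" "module (scale_minus (opposite V))"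
    using assms by (simp_all add: linear_jordan_pair_def opposite_def)
  ultimately show ?thesis
    using assms
    by (simp add: linear_jordan_pair_def opposite_dual_extension trilinear_dual_extension
        jordan_identities_dual_extension)
qed


subsection \<open>Algebraic differential and symmetric spaces\<close>

text \<open>
  \<open>F\<close> is the scalar extension of \<open>f\<close>, defined by the same formula on the subset \<open>N\<close> of
  \<open>V \<otimes> K[\<epsilon>]\<close>. Membership in \<open>N\<close> ensures that \<open>F\<close> is evaluated only where its formula is
  meaningful.
\<close>

definition has_algebraic_differential ::
  "'v dualnum set \<Rightarrow> ('v dualnum \<Rightarrow> 'v dualnum) \<Rightarrow> ('v \<Rightarrow> 'v) \<Rightarrow> 'v \<Rightarrow> ('v \<Rightarrow> 'v) \<Rightarrow> bool" where
  "has_algebraic_differential N F f x D \<longleftrightarrow>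
     (\<forall>v. Dual x v \<in> N \<and> F (Dual x v) = Dual (f x) (D v))"

text \<open>\<open>N\<close> and \<open>\<Sigma>\<close> are the scalar extensions of \<open>M\<close> and \<open>\<sigma>\<close>; the last condition is (S4).\<close>

definition symmetric_space ::
  "'v::ab_group_add set \<Rightarrow> ('v \<Rightarrow> 'v \<Rightarrow> 'v)
     \<Rightarrow> 'v dualnum set \<Rightarrow> ('v dualnum \<Rightarrow> 'v dualnum \<Rightarrow> 'v dualnum) \<Rightarrow> bool" where
  "symmetric_space M \<sigma> N \<Sigma> \<longleftrightarrow>
     reflection_space M \<sigma> \<and>
     (\<forall>x\<in>M. has_algebraic_differential N (\<Sigma> (Dual x 0)) (\<sigma> x) x uminus)"

end

theory Submission
  imports Defs "HOL-Library.Product_Plus"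
begin

text \<open>
  The module \<open>V\<^sup>+\<close> with the product \<open>x \<cdot> y = T(x,a,y)/2\<close> is a Jordan algebra, and in its unital
  hull one has \<open>U(1 + x)(1 + z) = 1 + Q(x)(z)\<close>, where \<open>Q(x)\<close> is the map \<^const>\<open>U_quad\<close>. The
  fundamental formula of the hull therefore reads \<open>Q(Q(x)y) = Q(x) Q(y) Q(x)\<close>. Moreover
  \<open>\<sigma>\<^sub>0(z)\<close> is the unique solution \<open>w\<close> of \<open>Q(z)w = z\<close>, i.e. \<open>1 + w\<close> is the inverse of \<open>1 + z\<close>.
  These two facts alone imply the axioms of a reflection space. The differential is obtained from
  \<open>{X, X\<^sup>-\<^sup>1, v} = 2v\<close> in the hull with \<open>X = 1 + x\<close>.
\<close>

section \<open>Jordan pair identities without scalars\<close>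

text \<open>Torsion-freeness replaces division by 2 and 3, so that the same identities serve the
  pair, its opposite, and the unital hull, where both slots carry one and the same triple
  product.\<close>

locale additive_jordan_pair =
  fixes T :: "'p::ab_group_add \<Rightarrow> 'm::ab_group_add \<Rightarrow> 'p \<Rightarrow> 'p"
    and S :: "'m \<Rightarrow> 'p \<Rightarrow> 'm \<Rightarrow> 'm"
  assumes T_add_left: "T (x + x') y z = T x y z + T x' y z"
    and T_add_middle: "T x (y + y') z = T x y z + T x y' z"
    and S_add_left: "S (y + y') x w = S y x w + S y' x w"
    and S_add_middle: "S y (x + x') w = S y x w + S y x' w"
    and T_commute: "T x y z = T z y x"
    and S_commute: "S y x w = S w x y"
    and T_jordan: "T u v (T x y z) = T (T u v x) y z - T x (S v u y) z + T x y (T u v z)"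
    and S_jordan: "S v u (S y x w) = S (S v u y) x w - S y (T u v x) w + S y x (S v u w)"
    and two_torsion_free: "p + p = (0::'p) \<Longrightarrow> p = 0"
    and two_torsion_free': "m + m = (0::'m) \<Longrightarrow> m = 0"
    and three_torsion_free: "p + p + p = (0::'p) \<Longrightarrow> p = 0"
    and three_torsion_free': "m + m + m = (0::'m) \<Longrightarrow> m = 0"
begin

lemma opposite: "additive_jordan_pair S T"
  by unfold_locales
    (fact T_add_left T_add_middle S_add_left S_add_middle T_commute S_commute T_jordan S_jordan
      two_torsion_free two_torsion_free' three_torsion_free three_torsion_free')+

lemma T_add_right: "T x y (z + z') = T x y z + T x y z'"
  by (simp only: T_commute[of x y] T_add_left)

lemma T_zero [simp]: "T 0 y z = 0" "T x 0 z = 0" "T x y 0 = 0"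
  using T_add_left[of 0 0 y z] T_add_middle[of x 0 0 z] T_add_right[of x y 0 0] by simp_all

lemma T_uminus: "T (- x) y z = - T x y z" "T x (- y) z = - T x y z" "T x y (- z) = - T x y z"
  using T_add_left[of x "- x" y z] T_add_middle[of x y "- y" z] T_add_right[of x y z "- z"]
  by (simp_all add: eq_neg_iff_add_eq_0 add.commute)

lemma double_cancel: "p + p = q + q \<Longrightarrow> p = q" for p q :: 'p
  using two_torsion_free[of "p - q"] by (simp add: algebra_simps)

text \<open>The Jordan identity computes the commutator of \<open>T x y\<close> with
  \<open>T u v\<close> in both orders; the two results add up to zero.\<close>

lemma T_exchange:
  "T (T x y u) v z + T (T u v x) y z = T u (S y x v) z + T x (S v u y) z"
proof -
  have "T x y (T u v z) = T (T x y u) v z - T u (S y x v) z + T u v (T x y z)"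
    by (rule T_jordan)
  moreover have "T u v (T x y z) = T (T u v x) y z - T x (S v u y) z + T x y (T u v z)"
    by (rule T_jordan)
  ultimately have "T x y (T u v z) = T (T x y u) v z - T u (S y x v) z
      + (T (T u v x) y z - T x (S v u y) z + T x y (T u v z))"
    by (simp only:)
  then show ?thesis
    by (simp add: algebra_simps)
qed

text \<open>The Jordan identity and \<open>T_exchange\<close> give two linear relations between the
  three terms. Eliminating \<open>?A'\<close> leaves three times \<open>?A - ?C\<close>, which is
  where 3-torsion enters.\<close>

lemma T_T_same: "T x y (T x z x) = T x (S y x z) x"
  and T_T_same': "T (T x y x) z x = T x (S y x z) x"
proof -
  let ?A = "T (T x y x) z x" and ?A' = "T x y (T x z x)" and ?C = "T x (S y x z) x"
  have 1: "?A' = ?A - ?C + ?A"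
    using T_jordan[of x y x z x] T_commute[of x z "T x y x"] by simp
  have 2: "?A + ?A' = ?C + ?C"
    using T_exchange[of x y x z x] T_commute[of x y "T x z x"] S_commute[of z x y] by simp
  have "?A - ?C + (?A - ?C) + (?A - ?C) = (?A + ?A') - (?C + ?C)"
    unfolding 1 by (simp add: algebra_simps)
  also have "\<dots> = 0"
    by (simp only: 2 diff_self)
  finally have "?A - ?C = 0"
    by (rule three_torsion_free)
  then show "?A = ?C" by simp
  then show "?A' = ?C" using 1 by simp
qed

text \<open>With \<open>T x y x\<close> = 2Q(x)y this is eight times Q(Q(x)y) = Q(x)Q(y)Q(x).
  Expanding \<open>T x y (T x z p)\<close> by the Jordan identity expresses \<open>T p z p\<close>
  by terms of the form \<open>T x _ x\<close>, whose middle entries are compared by the Jordan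
  identity for \<open>S\<close>.\<close>

lemma fundamental_formula: "T (T x y x) z (T x y x) = T x (S y (T x z x) y) x"
proof -
  define p where "p = T x y x"
  have p: "T x w p = T x (S y x w) x" for w
    using T_T_same'[of x y w] T_commute[of p w x] by (simp add: p_def)
  have "T x y (T x z p) = T p z p - T x (S y x z) p + T x z (T x y p)"
    unfolding p_def by (rule T_jordan)
  moreover have "T x y (T x z p) = T x (S y x (S y x z)) x"
    by (simp only: p T_T_same)
  moreover have "T x (S y x z) p = T x (S y x (S y x z)) x"
    by (simp only: p)
  moreover have "T x z (T x y p) = T x (S z x (S y x y)) x"
    by (simp only: p T_T_same)
  ultimately have "T p z p = T x (S y x (S y x z)) x + T x (S y x (S y x z)) x
      - T x (S z x (S y x y)) x"
    by (simp add: algebra_simps)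
  moreover have "S z x (S y x y) = S (S z x y) x y - S y (T x z x) y + S y x (S z x y)"
    by (rule S_jordan)
  then have "S z x (S y x y) + S y (T x z x) y = S y x (S y x z) + S y x (S y x z)"
    by (simp add: S_commute[of z x y] S_commute[of "S y x z" x y] algebra_simps)
  then have "T x (S z x (S y x y)) x + T x (S y (T x z x) y) x
      = T x (S y x (S y x z)) x + T x (S y x (S y x z)) x"
    by (simp flip: T_add_middle)
  then have "T x (S y (T x z x) y) x = T x (S y x (S y x z)) x + T x (S y x (S y x z)) x
      - T x (S z x (S y x y)) x"
    by (simp add: eq_diff_eq add.commute)
  ultimately show ?thesis
    unfolding p_def by simp
qed

lemma fundamental_formula_polarized: "T (T x y x) z (T x w x) = T x (S y (T x z x) w) x"
proof (rule double_cancel)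
  interpret opp: additive_jordan_pair S T by (rule opposite)
  \<comment> \<open>Linearization in \<open>y\<close>: by commutativity the mixed terms occur in
    equal pairs.\<close>
  have "T (T x (y + w) x) z (T x (y + w) x) = T x (S (y + w) (T x z x) (y + w)) x"
    by (rule fundamental_formula)
  then show "T (T x y x) z (T x w x) + T (T x y x) z (T x w x)
      = T x (S y (T x z x) w) x + T x (S y (T x z x) w) x"
    by (simp add: T_add_left T_add_middle T_add_right S_add_left opp.T_add_right
        fundamental_formula T_commute[of "T x w x" z "T x y x"] S_commute[of w "T x z x" y]
        algebra_simps)
qed

text \<open>For an invertible element \<open>x\<close> of a Jordan algebra, the hypothesis says that \<open>y\<close> is its inverse.\<close>

lemma T_inverse:
  assumes "T x y x = x + x"
  shows "T x y (T x u x) = T x u x + T x u x"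
proof (rule double_cancel)
  have "T x y (T x u x) = T (x + x) u x - T x (S y x u) x + T x u (x + x)"
    using T_jordan[of x y x u x] assms by simp
  then show "T x y (T x u x) + T x y (T x u x) = T x u x + T x u x + (T x u x + T x u x)"
    using T_T_same[of x y u] by (simp add: T_add_left T_add_right algebra_simps)
qed

end

section \<open>Reflection spaces from a quadratic map\<close>

lemma reflection_space_cong:
  assumes "\<And>x y. x \<in> M \<Longrightarrow> y \<in> M \<Longrightarrow> \<sigma> x y = \<sigma>' x y" "reflection_space M \<sigma>'"
  shows "reflection_space M \<sigma>"
  using assms unfolding reflection_space_def by simp

text \<open>The model is a group with \<open>q x y\<close> = xyx and neutral element
  \<open>e\<close>; the U-operator of a unital Jordan algebra satisfies the same two laws.\<close>

locale quadratic_set =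
  fixes q :: "'v \<Rightarrow> 'v \<Rightarrow> 'v" and e :: 'v
  assumes q_base: "q e = id"
    and q_q: "q (q x y) = q x \<circ> q y \<circ> q x"
begin

definition units :: "'v set" where
  "units = {x. bij (q x)}"

text \<open>For a unit this is the only solution \<open>w\<close> of \<open>q x w = x\<close>; in
  the group model it is the usual inverse.\<close>

definition inverse :: "'v \<Rightarrow> 'v" where
  "inverse x = inv (q x) x"

lemma base_unit: "e \<in> units"
  by (simp add: units_def q_base)

lemma q_unit: "x \<in> units \<Longrightarrow> y \<in> units \<Longrightarrow> q x y \<in> units"
  by (simp add: units_def q_q bij_comp)

lemma q_inverse: "x \<in> units \<Longrightarrow> q x (inverse x) = x"
  by (simp add: units_def inverse_def bij_is_surj surj_f_inv_f)

lemma inverse_unique: "x \<in> units \<Longrightarrow> q x y = x \<Longrightarrow> inverse x = y"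
  by (auto simp: units_def inverse_def bij_is_inj inv_f_eq)

text \<open>Applying \<open>q\<close> to \<open>q x (inverse x) = x\<close> gives
  \<open>q x \<circ> q (inverse x) \<circ> q x = q x\<close>, and the bijection \<open>q x\<close>
  cancels on either side.\<close>

lemma q_inverse_cancel:
  assumes "x \<in> units"
  shows "q x (q (inverse x) z) = z" "q (inverse x) (q x z) = z"
proof -
  have q: "q x (q (inverse x) (q x w)) = q x w" for w
    using q_q[of x "inverse x"] q_inverse[OF assms] by (metis comp_apply)
  then show "q (inverse x) (q x z) = z"
    using assms unfolding units_def by (metis bij_is_inj injD mem_Collect_eq)
  obtain w where "z = q x w"
    using assms unfolding units_def by (metis bij_is_surj mem_Collect_eq surjD)
  then show "q x (q (inverse x) z) = z"
    using q by simp
qed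

lemma inverse_unit: "x \<in> units \<Longrightarrow> inverse x \<in> units"
  using o_bij[of "q x" "q (inverse x)"] by (simp add: fun_eq_iff q_inverse_cancel units_def)

lemma inverse_inverse: "x \<in> units \<Longrightarrow> inverse (inverse x) = x"
  using q_inverse_cancel(2)[of x "inverse x"]
  by (intro inverse_unique inverse_unit) (simp_all add: q_inverse)

lemma inverse_q: "x \<in> units \<Longrightarrow> y \<in> units \<Longrightarrow> inverse (q x y) = q (inverse x) (inverse y)"
  by (intro inverse_unique q_unit) (simp_all add: q_q q_inverse_cancel q_inverse)

text \<open>In the group model the symmetry is xy^-1x. Since inversion is compatible with
  \<open>q\<close> and involutive, both sides of (S3) become
  \<open>q x (q (inverse y) (q x (inverse z)))\<close>.\<close>

lemma reflection_space_units: "reflection_space units (\<lambda>x y. q x (inverse y))"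
  unfolding reflection_space_def
  by (simp add: q_unit inverse_unit q_inverse inverse_q inverse_inverse q_inverse_cancel q_q)

end

section \<open>Halves and dual numbers\<close>

lemma half_unique:
  assumes "(h::'k::comm_ring_1) + h = 1"
  shows "half = h"
  unfolding half_def
proof (rule the_equality)
  show h: "2 * h = 1"
    using assms by (simp only: mult_2)
  show "g = h" if "2 * g = 1" for g
    using h that by (metis mult.assoc mult.commute mult_1_left)
qed

lemma half_double:
  assumes "(2::'k::comm_ring_1) dvd 1"
  shows "(half::'k) + half = 1"
proof -
  from assms obtain h :: 'k where "1 = 2 * h" ..
  then have "h + h = 1"
    by (simp only: mult_2)
  then show ?thesis
    by (simp only: half_unique)
qed

text \<open>\<open>F\<close> is triangular with diagonal \<open>f\<close>: invert \<open>f\<close>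
  on the base component, subtract the contribution of \<open>g\<close>, then invert \<open>f\<close>
  on the infinitesimal component.\<close>

lemma bij_dual:
  fixes f :: "'v::ab_group_add \<Rightarrow> 'v"
  assumes "bij f" and F: "\<And>z w. F (Dual z w) = Dual (f z) (f w + g z)"
  shows "bij F"
proof (rule bijI)
  show "inj F"
  proof (rule injI)
    fix P Q
    assume *: "F P = F Q"
    obtain z w z' w' where PQ: "P = Dual z w" "Q = Dual z' w'"
      by (cases P; cases Q)
    with * have "f z = f z'" "f w + g z = f w' + g z'"
      by (simp_all add: F)
    moreover from this(1) have "z = z'"
      using bij_is_inj[OF assms(1)] by (simp add: inj_eq)
    ultimately show "P = Q"
      using bij_is_inj[OF assms(1)] by (simp add: PQ inj_eq)
  qed
  show "surj F"
  proof (rule surjI)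
    fix P
    show "F (case P of Dual z w \<Rightarrow> Dual (inv f z) (inv f (w - g (inv f z)))) = P"
      using bij_is_surj[OF assms(1)] by (cases P) (simp add: F surj_f_inv_f)
  qed
qed

text \<open>The form with \<open>of_nat\<close> covers 2 and 3 at once.\<close>

lemma dvd_one_dual:
  assumes "of_nat n dvd (1::'k::comm_ring_1)"
  shows "of_nat n dvd (1::'k dualnum)"
proof -
  have n: "of_nat n = (Dual (of_nat n) 0 :: 'k dualnum)" for n
    by (induction n) (simp_all add: zero_dualnum_def one_dualnum_def)
  from assms obtain h :: 'k where "1 = of_nat n * h" ..
  then have "1 = of_nat n * Dual h 0"
    by (simp add: n one_dualnum_def)
  then show ?thesis ..
qed

section \<open>The Jordan pair with its scalars\<close>

text \<open>A locale with \<open>a\<close> as parameter can be interpreted a second time, over the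
  dual numbers with \<open>Dual a 0\<close>.\<close>

locale linear_jordan_pair_with_sixth =
  fixes V :: "('k::comm_ring_1, 'p::ab_group_add, 'm::ab_group_add) jordan_pair_data"
    and a :: 'm
  assumes two: "(2 :: 'k) dvd 1"
    and three: "(3 :: 'k) dvd 1"
    and pair: "linear_jordan_pair V"
begin

abbreviation "s \<equiv> scale_plus V"
abbreviation "r \<equiv> scale_minus V"
abbreviation "T \<equiv> triple_plus V"
abbreviation "S \<equiv> triple_minus V"
text \<open>This is Q(a): V^+ -> V^-. In terms of it, B(x,-a) = id + T(x,a) + Q(x)A.\<close>

abbreviation "A \<equiv> Qop (opposite V) a"

sublocale plus: module s
  using pair by (simp add: linear_jordan_pair_def)

sublocale minus: module r
  using pair by (simp add: linear_jordan_pair_def)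

lemma trilinear: "trilinear V" "trilinear (opposite V)"
  using pair by (simp_all add: linear_jordan_pair_def)

lemmas T_linear = trilinearD[OF trilinear(1)]
lemmas S_linear = trilinearD[OF trilinear(2), unfolded opposite_def jordan_pair_data.simps]

lemma double_half: "s half x + s half x = x" "r half y + r half y = y"
  by (simp_all add: half_double[OF two] flip: plus.scale_left_distrib minus.scale_left_distrib)

lemma third: "\<exists>t::'k. t + t + t = 1"
proof -
  from three obtain t :: 'k where "1 = 3 * t" ..
  then have t: "t + t + t = 1"
    by (simp add: numeral_3_eq_3 algebra_simps)
  then show ?thesis ..
qed

lemma torsion_free:
  "x + x = 0 \<Longrightarrow> x = 0" "x + x + x = 0 \<Longrightarrow> x = 0"
  "y + y = 0 \<Longrightarrow> y = 0" "y + y + y = 0 \<Longrightarrow> y = 0" for x :: 'p and y :: 'm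
proof -
  obtain t :: 'k where t: "t + t + t = 1"
    using third by blast
  show "x = 0" if "x + x = 0"
    using double_half(1)[of x] that by (metis plus.scale_right_distrib plus.scale_zero_right)
  show "x = 0" if "x + x + x = 0"
  proof -
    have "s t (x + x + x) = s (t + t + t) x"
      by (simp only: plus.scale_left_distrib plus.scale_right_distrib)
    with that t show ?thesis by simp
  qed
  show "y = 0" if "y + y = 0"
    using double_half(2)[of y] that by (metis minus.scale_right_distrib minus.scale_zero_right)
  show "y = 0" if "y + y + y = 0"
  proof -
    have "r t (y + y + y) = r (t + t + t) y"
      by (simp only: minus.scale_left_distrib minus.scale_right_distrib)
    with that t show ?thesis by simp
  qed
qed

lemma T_eqs:
  "T x y z = T z y x"
  "T u v (T x y z) = T (T u v x) y z - T x (S v u y) z + T x y (T u v z)"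
  using pair unfolding linear_jordan_pair_def jordan_identities_def by blast+

lemma S_eqs:
  "S y x w = S w x y"
  "S v u (S y x w) = S (S v u y) x w - S y (T u v x) w + S y x (S v u w)"
  using pair
  unfolding linear_jordan_pair_def jordan_identities_def opposite_def jordan_pair_data.simps
  by blast+

sublocale additive_jordan_pair T S
  by unfold_locales
    (fact T_linear S_linear T_eqs S_eqs torsion_free)+

interpretation opp: additive_jordan_pair S T
  by (rule opposite)

section \<open>The unital hull of the Jordan algebra defined by \<open>a\<close>\<close>

lemma A_eq: "A y = r half (S a y a)"
  by (simp add: Qop_def opposite_def)

lemma A_linear: "A (x + y) = A x + A y" "A (s c x) = r c (A x)"
  by (simp_all add: A_eq S_linear minus.scale_right_distrib mult.commute)

lemma A_zero [simp]: "A 0 = 0"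
  using A_linear(1)[of 0 0] by simp

lemma A_double: "A y + A y = S a y a"
  by (simp add: A_eq double_half)

text \<open>The polarized fundamental formula of the opposite pair at \<open>a\<close>, with the
  factors 2 divided out.\<close>

lemma A_fundamental: "A (T v (A u) y) = S (A v) u (A y)"
  using opp.fundamental_formula_polarized[of a v u y]
  by (simp add: A_eq S_linear T_linear)

lemma A_T: "A (T u a y) = S a u (A y)"
  using opp.T_T_same[of a u y] by (simp add: A_eq S_linear)

text \<open>\<open>T_exchange\<close> with \<open>a\<close> in both middle slots;
  \<open>S a v a\<close> is twice \<open>A v\<close>, so everything appears doubled.\<close>

lemma T_A_exchange: "T u (A v) y + T v (A u) y = T (T u a v) a y"
proof (rule double_cancel)
  have "T (T v a u) a y + T (T u a v) a y = T u (S a v a) y + T v (S a u a) y"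
    by (rule T_exchange)
  then show "T u (A v) y + T v (A u) y + (T u (A v) y + T v (A u) y)
      = T (T u a v) a y + T (T u a v) a y"
    by (simp add: T_commute[of v a u] T_add_middle algebra_simps flip: A_double)
qed

text \<open>The triple product of the unital hull of the Jordan algebra with product
  \<open>x \<cdot> y = T x a y / 2\<close>: its elements \<open>(\<alpha>, x)\<close> stand for \<open>\<alpha> 1 + x\<close>.\<close>

fun hull_triple :: "'k \<times> 'p \<Rightarrow> 'k \<times> 'p \<Rightarrow> 'k \<times> 'p \<Rightarrow> 'k \<times> 'p" where
  "hull_triple (\<alpha>, x) (\<beta>, y) (\<gamma>, z) =
    (\<alpha> * \<beta> * \<gamma> + \<alpha> * \<beta> * \<gamma>,
     T x (r \<beta> a + A y) z + s \<alpha> (T y a z) + s \<gamma> (T x a y)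
     + (s (\<alpha> * \<beta>) z + s (\<beta> * \<gamma>) x + s (\<alpha> * \<gamma>) y)
     + (s (\<alpha> * \<beta>) z + s (\<beta> * \<gamma>) x + s (\<alpha> * \<gamma>) y))"

lemmas scale_rules = plus.scale_left_distrib plus.scale_right_distrib
  minus.scale_left_distrib minus.scale_right_distrib

lemma hull_add:
  "hull_triple (X + X') Y Z = hull_triple X Y Z + hull_triple X' Y Z"
  "hull_triple X (Y + Y') Z = hull_triple X Y Z + hull_triple X Y' Z"
  "hull_triple X Y (Z + Z') = hull_triple X Y Z + hull_triple X Y Z'"
  by (cases X; cases X'; cases Y; cases Y'; cases Z; cases Z';
      simp add: T_linear A_linear scale_rules algebra_simps)+

lemma hull_commute: "hull_triple X Y Z = hull_triple Z Y X"
  by (cases X; cases Y; cases Z)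
    (simp add: T_commute algebra_simps)

text \<open>As a middle factor, (\<beta>, y) acts on V^+ through the element \<beta>a + Q(a)y of
  V^-. This passage to V^- turns the hull triple with middle entry in V^+ into \<open>S\<close>,
  which is what the middle term of the Jordan identity requires.\<close>

lemma A_hull_triple:
  "A (snd (hull_triple (\<nu>, v) (0, u) (\<beta>, y))) = S (r \<nu> a + A v) u (r \<beta> a + A y)"
proof -
  have "A (T v a u) = S (A v) u a"
    by (simp only: T_commute[of v a u] A_T S_commute[of a])
  then show ?thesis
    by (simp add: A_linear A_fundamental A_T S_linear scale_rules mult.commute
        flip: A_double)
qed

lemma hull_triple_jordan:
  "hull_triple U W (hull_triple X Y Z) = hull_triple (hull_triple U W X) Y Z
     - hull_triple X (hull_triple W U Y) Z + hull_triple X Y (hull_triple U W Z)"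
proof -
  let ?H = hull_triple
  \<comment> \<open>\<Delta> is the defect of the Jordan identity. Being additive in each argument,
    it need only be checked on scalars and on elements of V^+.\<close>
  define \<Delta> where "\<Delta> U W X Y Z = ?H U W (?H X Y Z) - (?H (?H U W X) Y Z
     - ?H X (?H W U Y) Z + ?H X Y (?H U W Z))" for U W X Y Z
  have add: "\<Delta> (U + U') W X Y Z = \<Delta> U W X Y Z + \<Delta> U' W X Y Z"
     "\<Delta> U (W + W') X Y Z = \<Delta> U W X Y Z + \<Delta> U W' X Y Z"
     "\<Delta> U W (X + X') Y Z = \<Delta> U W X Y Z + \<Delta> U W X' Y Z"
     "\<Delta> U W X (Y + Y') Z = \<Delta> U W X Y Z + \<Delta> U W X Y' Z"
     "\<Delta> U W X Y (Z + Z') = \<Delta> U W X Y Z + \<Delta> U W X Y Z'"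
    for U U' W W' X X' Y Y' Z Z'
    by (simp_all add: \<Delta>_def hull_add algebra_simps)
  have split: "P = (fst P, 0) + (0, snd P)" for P :: "'k \<times> 'p"
    by (cases P) simp
  \<comment> \<open>With the first, third and fifth arguments in V^+, this is the Jordan identity of
    the pair itself, transported by \<open>A_hull_triple\<close>.\<close>
  have 1: "\<Delta> (0, u) (\<nu>, v) (0, x) (\<beta>, y) (0, z) = 0" for u v x y z \<nu> \<beta>
  proof -
    have H: "?H (0, u) (\<nu>, v) (0, x) = (0, T u (r \<nu> a + A v) x)" for u \<nu> v x
      by simp
    define w where "w = snd (?H (\<nu>, v) (0, u) (\<beta>, y))"
    have w: "A w = S (r \<nu> a + A v) u (r \<beta> a + A y)"
      unfolding w_def by (rule A_hull_triple)
    have "?H (\<nu>, v) (0, u) (\<beta>, y) = (0, w)"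
      by (simp add: w_def)
    then show ?thesis
      using T_jordan[of u "r \<nu> a + A v" x "r \<beta> a + A y" z]
      by (simp only: \<Delta>_def H w) (simp add: zero_prod_def)
  qed
  note [[simproc del: int_combine_numerals]] \<comment> \<open>it would undo the distribution of \<open>c + c\<close>\<close>
  \<comment> \<open>Used as rewrite rules, these eliminate products nested through \<open>a\<close>
    and so bring both sides of the next three cases to a common form.\<close>
  have nest: "T (T u a v) a y = T u (A v) y + T v (A u) y"
    and nest': "T y a (T u a v) = T u (A v) y + T v (A u) y" for u v y
    using T_A_exchange[of u v y] T_commute[of y a] by simp_all
  have 2: "\<Delta> (0, u) (\<nu>, v) (\<alpha>, 0) (\<beta>, y) (\<gamma>, 0) = 0" for u v \<nu> \<alpha> \<beta> \<gamma> y
    by (simp add: \<Delta>_def zero_prod_def T_linear A_linear scale_rules mult_2_right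
        nest nest' T_commute algebra_simps)
  have 31: "\<Delta> (0, u) (\<nu>, v) (\<alpha>, 0) (\<beta>, 0) (0, z) = 0" for u v \<nu> \<alpha> \<beta> z
    by (simp add: \<Delta>_def zero_prod_def T_linear A_linear scale_rules mult_2_right
        nest nest' T_commute algebra_simps)
  have 32: "\<Delta> (0, u) (\<nu>, 0) (\<alpha>, 0) (0, y) (0, z) = 0" for u \<nu> \<alpha> y z
    by (simp add: \<Delta>_def zero_prod_def T_linear A_linear scale_rules mult_2_right
        nest nest' T_commute algebra_simps)
  \<comment> \<open>Four entries lie in V^+ here, so the Jordan identity of the pair is needed too,
    with \<open>A v\<close> and \<open>a\<close> as its V^- entries.\<close>
  have 33: "\<Delta> (0, u) (0, v) (\<alpha>, 0) (0, y) (0, z) = 0" for u v \<alpha> y z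
  proof -
    have "T u (A v) (T y a z) = T (T u (A v) y) a z - T y (A (T u a v)) z + T y a (T u (A v) z)"
      by (simp only: T_jordan[of u "A v" y] A_T S_commute[of a])
    moreover have "T (T u a v) (A y) z + T y (A (T u a v)) z = T (T u (A v) y + T v (A u) y) a z"
      by (simp only: T_A_exchange)
    then have "T (T u (A v) y) a z =
        T (T u a v) (A y) z + T y (A (T u a v)) z - T (T v (A u) y) a z"
      by (simp add: T_add_left)
    ultimately have "T u (A v) (T y a z) =
        T (T u a v) (A y) z - T (T v (A u) y) a z + T y a (T u (A v) z)"
      by simp
    then show ?thesis
      by (simp add: \<Delta>_def zero_prod_def T_linear scale_rules plus.scale_right_diff_distrib)
  qed
  have 3: "\<Delta> (0, u) W (\<alpha>, 0) Y (0, z) = 0" for u W \<alpha> Y z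
    by (subst split[of W], subst split[of Y]) (simp only: add 31 32 33 add_0)
  have \<Delta>_commute: "\<Delta> U W X Y Z = \<Delta> U W Z Y X" for U W X Y Z
    by (simp add: \<Delta>_def hull_commute[of X _ Z] hull_commute[of "?H U W X"]
        hull_commute[of "?H U W Z"])
  have 4: "\<Delta> (0, u) W (0, x) Y (\<gamma>, 0) = 0" for u W x Y \<gamma>
    by (subst \<Delta>_commute) (rule 3)
  have 5: "\<Delta> (0, u) W X Y Z = 0" for u W X Y Z
    by (cases W; cases Y; subst split[of X]; subst split[of Z]) (simp only: add 1 2 3 4 add_0)
  have 6: "\<Delta> (\<omega>, 0) (\<nu>, 0) X Y Z = 0" for \<omega> \<nu> X Y Z
    by (cases X; cases Y; cases Z)
      (simp add: \<Delta>_def zero_prod_def T_linear A_linear scale_rules mult_2_right algebra_simps)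
  \<comment> \<open>A scalar acts alike from the first and the second slot, so a scalar first
    argument can be moved to the second, where \<open>5\<close> and \<open>6\<close> apply.\<close>
  have "?H (\<omega>, 0) W P = ?H W (\<omega>, 0) P" for \<omega> W P
    by (cases W; cases P) (simp add: T_linear algebra_simps)
  then have 7: "\<Delta> (\<omega>, 0) W X Y Z = \<Delta> W (\<omega>, 0) X Y Z" for \<omega> W X Y Z
    by (simp only: \<Delta>_def)
  have "\<Delta> (\<omega>, 0) W X Y Z = 0" for \<omega> W X Y Z
    by (subst 7, subst split[of W]) (simp only: add 5 6 add_0)
  then have "\<Delta> U W X Y Z = 0"
    by (subst split[of U]) (simp only: add 5 add_0)
  then show ?thesis
    by (simp add: \<Delta>_def)
qed

text \<open>A Jordan triple system paired with itself is a Jordan pair, which makes the fundamental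
  formula and \<open>T_inverse\<close> available in the hull.\<close>

interpretation hull: additive_jordan_pair hull_triple hull_triple
proof
  obtain t :: 'k where t: "t + t + t = 1"
    using third by blast
  have "c = (half + half) * c" "c = (t + t + t) * c" for c :: 'k
    by (simp_all only: half_double[OF two] t mult_1_left)
  then have c: "c = half * (c + c)" "c = t * (c + c + c)" for c :: 'k
    by (simp_all only: distrib_left distrib_right)
  show "P = 0" if "P + P = 0" for P :: "'k \<times> 'p"
    using that c(1)[of "fst P"] two_torsion_free[of "snd P"]
    by (cases P) (simp add: zero_prod_def)
  show "P = 0" if "P + P + P = 0" for P :: "'k \<times> 'p"
    using that c(2)[of "fst P"] three_torsion_free[of "snd P"]
    by (cases P) (simp add: zero_prod_def)
qed (fact hull_add hull_commute hull_triple_jordan)+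

section \<open>The fundamental formula for the quadratic map\<close>

abbreviation "q \<equiv> U_quad V a"
abbreviation "B \<equiv> \<lambda>x. bergman V x (- a)"

lemma Qop_uminus: "Qop V (- x) y = Qop V x y" "Qop V x (- y) = - Qop V x y"
  by (simp_all add: Qop_def T_uminus)

lemma Qop_add: "Qop V x (y + y') = Qop V x y + Qop V x y'"
  by (simp add: Qop_def T_add_middle scale_rules)

lemma Qop_scale: "Qop V x (r c y) = s c (Qop V x y)"
  by (simp add: Qop_def T_linear mult.commute)

lemma Qop_zero [simp]: "Qop V x 0 = 0"
  by (simp add: Qop_def)

lemma Qop_double: "Qop V x y + Qop V x y = T x y x"
  by (simp add: Qop_def double_half)

lemma bergman_eq: "B x z = z + T x a z + Qop V x (A z)"
  by (simp add: bergman_def T_uminus A_eq Qop_def opposite_def opp.T_uminus)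

lemma q_eq: "q x z = B x z + (x + x + Qop V x a)"
  using plus.scale_left_distrib[of 1 1 x] by (simp add: U_quad_def translation_def)

text \<open>The triple product is normalized by {X,Y,X} = 2U(X)Y, hence the two equal
  summands.\<close>

lemma hull_triple_q: "hull_triple (1, x) (1, y) (1, x) = (1, q x y) + (1, q x y)"
  by (simp add: q_eq bergman_eq Qop_add T_commute[of y a x] algebra_simps flip: Qop_double)

lemma hull_triple_B: "hull_triple (1, x) (0, y) (1, x) = (0, B x y) + (0, B x y)"
  by (simp add: bergman_eq Qop_add T_commute[of y a x] algebra_simps flip: Qop_double)

lemma q_q: "q (q x y) = q x \<circ> q y \<circ> q x"
proof
  fix z
  let ?H = hull_triple and ?P = "(1::'k, q (q x y) z)" and ?P' = "(1::'k, q x (q y (q x z)))"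
  have "?H (?H (1, x) (1, y) (1, x)) (1, z) (?H (1, x) (1, y) (1, x))
      = ?H (1, x) (?H (1, y) (?H (1, x) (1, z) (1, x)) (1, y)) (1, x)"
    by (rule hull.fundamental_formula)
  \<comment> \<open>Each of the three U-operators on a side contributes a factor 2, giving eight
    copies; three halvings remove them.\<close>
  then have "?P + ?P + (?P + ?P) + (?P + ?P + (?P + ?P))
      = ?P' + ?P' + (?P' + ?P') + (?P' + ?P' + (?P' + ?P'))"
    by (simp only: hull_add hull_triple_q)
  then have "?P = ?P'"
    by (intro hull.double_cancel[of ?P] hull.double_cancel[of "?P + ?P"]
        hull.double_cancel[of "?P + ?P + (?P + ?P)"])
  then show "q (q x y) z = (q x \<circ> q y \<circ> q x) z"
    by simp
qed

lemma B_linear: "module_hom s s (B x)"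
  by unfold_locales
    (simp_all add: bergman_eq Qop_add Qop_scale T_linear A_linear scale_rules algebra_simps)

lemma q_zero: "q 0 = id"
  by (rule ext) (simp add: q_eq bergman_eq Qop_def)

sublocale quadratic_set q 0
  by unfold_locales (fact q_zero q_q)+

section \<open>The set \<open>U_set V a\<close> as the units, and the symmetry at 0 as
  inversion\<close>

lemma bij_B_iff: "bij (B x) \<longleftrightarrow> bij (q x)"
proof -
  let ?t = "\<lambda>z. z + (x + x + Qop V x a)" and ?t' = "\<lambda>z. z - (x + x + Qop V x a)"
  have "q x = ?t \<circ> B x" and "B x = ?t' \<circ> q x"
    by (simp_all add: fun_eq_iff q_eq)
  moreover have "bij ?t"
    by (rule o_bij[of ?t']) (auto simp: fun_eq_iff)
  moreover have "bij ?t'"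
    by (rule o_bij[of ?t]) (auto simp: fun_eq_iff)
  ultimately show ?thesis
    by (metis bij_comp)
qed

lemma U_set_eq: "U_set V a = units"
  by (simp add: U_set_def quasi_invertible_def general_linear_def B_linear bij_B_iff units_def)

text \<open>\<open>B z\<close> sends \<open>U_sym0 V a z\<close> to -z - Q(z)a, and the translation
  by 2z + Q(z)a in \<open>q z\<close> then yields \<open>z\<close>.\<close>

lemma U_sym0_eq: "z \<in> units \<Longrightarrow> U_sym0 V a z = inverse z"
proof (rule inverse_unique[symmetric])
  assume "z \<in> units"
  then have "bij (B z)"
    by (simp add: units_def bij_B_iff)
  interpret B: module_hom s s "B z"
    by (rule B_linear)
  have "B z (quasi_inverse V (- a) z) = z + Qop V z a"
    using \<open>bij (B z)\<close> by (simp add: quasi_inverse_def bij_is_surj surj_f_inv_f Qop_uminus)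
  then show "q z (U_sym0 V a z) = z"
    by (simp add: q_eq U_sym0_def B.neg)
qed

lemma bergman_uminus: "bergman V (- z) a = B z"
  by (simp add: fun_eq_iff bergman_eq) (simp add: bergman_def T_uminus Qop_uminus)

text \<open>Both sides use the same Bergman operator, and by linearity the sign passes through its
  inverse.\<close>

lemma U_sym0_eq_quasi_inverse: "z \<in> units \<Longrightarrow> U_sym0 V a z = quasi_inverse V a (- z)"
proof -
  assume "z \<in> units"
  then have "bij (B z)"
    by (simp add: units_def bij_B_iff)
  interpret B: module_hom s s "B z"
    by (rule B_linear)
  have "- inv (B z) y = inv (B z) (- y)" for y
    using \<open>bij (B z)\<close>
    by (metis B.neg bij_inv_eq_iff)
  then show ?thesis
    by (simp add: U_sym0_def quasi_inverse_def bergman_uminus Qop_uminus)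
qed

lemma U_sym_eq: "y \<in> units \<Longrightarrow> U_sym V a x y = q x (inverse y)"
  by (simp add: U_sym_def U_sym0_eq)

lemma reflection_space_U: "reflection_space (U_set V a) (U_sym V a)"
  unfolding U_set_eq
  by (rule reflection_space_cong[OF _ reflection_space_units]) (rule U_sym_eq)

section \<open>The differential of the symmetries\<close>

text \<open>\<open>T_inverse\<close> gives this for elements {X,U,X}; as \<open>B x\<close> is
  surjective, twice any element of V^+ has this form.\<close>

lemma hull_triple_inverse:
  assumes "x \<in> units"
  shows "hull_triple (1, x) (1, inverse x) (0, v) = (0, v) + (0, v)"
proof (rule hull.double_cancel)
  let ?X = "(1::'k, x)" and ?Y = "(1::'k, inverse x)"
  have "bij (B x)"
    using assms by (simp add: units_def bij_B_iff)
  then obtain u where "v = B x u"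
    by (metis bij_is_surj surjD)
  then have "hull_triple ?X (0, u) ?X = (0, v) + (0, v)"
    by (simp only: hull_triple_B)
  moreover have "hull_triple ?X ?Y ?X = ?X + ?X"
    by (simp only: hull_triple_q q_inverse[OF assms])
  ultimately have "hull_triple ?X ?Y ((0, v) + (0, v)) = (0, v) + (0, v) + ((0, v) + (0, v))"
    using hull.T_inverse[of ?X ?Y "(0, u)"] by simp
  then show "hull_triple ?X ?Y (0, v) + hull_triple ?X ?Y (0, v)
      = (0, v) + (0, v) + ((0, v) + (0, v))"
    by (simp only: hull_add)
qed

text \<open>2 and 3 stay invertible in the dual numbers, so all results so far hold for the extended
  pair.\<close>

interpretation dual: linear_jordan_pair_with_sixth "dual_extension V" "Dual a 0"
  using dvd_one_dual[of 2] dvd_one_dual[of 3] two three linear_jordan_pair_dual_extension[OF pair]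
  by unfold_locales simp_all

lemma half_dual: "half = (Dual half 0 :: 'k dualnum)"
  by (rule half_unique) (simp add: half_double[OF two] one_dualnum_def)

lemma Qop_dual: "Qop (dual_extension V) (Dual x v) (Dual y w) =
    Dual (Qop V x y) (T x y v + Qop V x w)"
proof -
  have "T v y x + T x w x + T x y v = T x y v + T x y v + T x w x"
    by (simp add: T_commute[of v y x] algebra_simps)
  then have "s half (T v y x + T x w x + T x y v) = T x y v + s half (T x w x)"
    by (simp add: scale_rules double_half)
  then show ?thesis
    by (simp add: Qop_def dual_extension_def half_dual)
qed

lemma A_dual: "dual.A (Dual z w) = Dual (A z) (A w)"
  by (simp add: A_eq dual.A_eq half_dual) (simp add: dual_extension_def opp.T_zero)

text \<open>This is the triangular shape required by \<open>bij_dual\<close>, with diagonal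
  \<open>B x\<close>.\<close>

lemma B_dual: "dual.B (Dual x v) (Dual z w) =
    Dual (B x z) (B x w + (T v a z + T x (A z) v))"
  by (simp add: bergman_eq dual.bergman_eq A_dual Qop_dual del: uminus_dualnum.simps)
    (simp add: dual_extension_def algebra_simps)

text \<open>The derivative of X -> U(X)Z in direction v is {X,Z,v}, which is why the hull triple
  appears.\<close>

lemma q_dual: "dual.q (Dual x v) (Dual z w) =
    Dual (q x z) (B x w + snd (hull_triple (1, x) (1, z) (0, v)))"
  by (simp add: q_eq dual.q_eq B_dual Qop_dual T_add_middle T_commute[of v a z] algebra_simps
      del: uminus_dualnum.simps)

lemma dual_unit:
  assumes "x \<in> units"
  shows "Dual x v \<in> dual.units"
proof -
  have "bij (B x)"
    using assms by (simp add: units_def bij_B_iff)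
  then have "bij (dual.B (Dual x v))"
    by (rule bij_dual) (rule B_dual)
  then show ?thesis
    by (simp add: dual.units_def dual.bij_B_iff del: uminus_dualnum.simps)
qed

lemma dual_U_sym:
  assumes x: "x \<in> units"
  shows "U_sym (dual_extension V) (Dual a 0) (Dual x 0) (Dual x v) = Dual x (- v)"
proof -
  obtain w w' where W: "dual.inverse (Dual x v) = Dual w w'"
    by (cases "dual.inverse (Dual x v)")
  have "dual.q (Dual x v) (Dual w w') = Dual x v"
    using dual.q_inverse[OF dual_unit[OF x]] W by metis
  then have q: "q x w = x" and w': "B x w' + snd (hull_triple (1, x) (1, w) (0, v)) = v"
    by (simp_all only: q_dual dualnum.inject)
  have w: "inverse x = w"
    by (rule inverse_unique) (fact x q)+
  \<comment> \<open>The infinitesimal part of the equation defining the inverse, with {X,X^-1,v} =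
    2v inserted.\<close>
  have "B x w' + (v + v) = v"
    using w' hull_triple_inverse[OF x, of v] by (simp add: w del: hull_triple.simps)
  then have "B x w' = - v"
    by (simp add: eq_neg_iff_add_eq_0 flip: add.assoc)
  \<comment> \<open>The symmetry is taken at the constant point \<open>Dual x 0\<close>, so the term
    in v drops out and only \<open>B x w'\<close> remains.\<close>
  then have "dual.q (Dual x 0) (Dual w w') = Dual x (- v)"
    using q hull_triple_inverse[OF x, of 0] by (simp add: q_dual w del: hull_triple.simps)
  then show ?thesis
    by (simp only: dual.U_sym_eq[OF dual_unit[OF x]] W)
qed

lemma algebraic_differential:
  assumes "x \<in> U_set V a"
  shows "has_algebraic_differential (U_set (dual_extension V) (Dual a 0))
    (U_sym (dual_extension V) (Dual a 0) (Dual x 0)) (U_sym V a x) x uminus"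
  using assms
  by (simp add: has_algebraic_differential_def U_set_eq dual.U_set_eq dual_unit dual_U_sym
      U_sym_eq q_inverse)

end

theorem theorem2p3:
  fixes V :: "('k::comm_ring_1, 'p::ab_group_add, 'm::ab_group_add) jordan_pair_data"
    and a :: 'm
  assumes two: "(2 :: 'k) dvd 1"
    and three: "(3 :: 'k) dvd 1"
    and pair: "linear_jordan_pair V"
  shows "(\<forall>x\<in>U_set V a. U_quad V a x ` U_set V a \<subseteq> U_set V a)
    \<and> U_sym0 V a ` U_set V a \<subseteq> U_set V a
    \<and> (\<forall>z\<in>U_set V a. quasi_invertible V (- z) a \<and> U_sym0 V a z = quasi_inverse V a (- z))
    \<and> reflection_space (U_set V a) (U_sym V a)
    \<and> 0 \<in> U_set V a
    \<and> (\<forall>z\<in>U_set V a. U_sym V a 0 z = U_sym0 V a z)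
    \<and> (\<forall>x\<in>U_set V a. \<forall>z\<in>U_set V a. quadratic_map (U_sym V a) 0 x z = U_quad V a x z)
    \<and> (\<forall>x\<in>U_set V a.
         has_algebraic_differential (U_set (dual_extension V) (Dual a 0))
           (U_sym (dual_extension V) (Dual a 0) (Dual x 0)) (U_sym V a x) x (\<lambda>v. - v))
    \<and> symmetric_space (U_set V a) (U_sym V a)
        (U_set (dual_extension V) (Dual a 0)) (U_sym (dual_extension V) (Dual a 0))"
proof -
  interpret linear_jordan_pair_with_sixth V a
    by unfold_locales (fact two three pair)+
  show ?thesis
  proof (intro conjI ballI)
    show "U_quad V a x ` U_set V a \<subseteq> U_set V a" if "x \<in> U_set V a" for x
      using that by (auto simp: U_set_eq q_unit)
    show "U_sym0 V a ` U_set V a \<subseteq> U_set V a"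
      by (auto simp: U_set_eq U_sym0_eq inverse_unit)
    show "quasi_invertible V (- z) a" if "z \<in> U_set V a" for z
      using that by (simp add: U_set_def quasi_invertible_def bergman_uminus)
    show "U_sym0 V a z = quasi_inverse V a (- z)" if "z \<in> U_set V a" for z
      using that by (simp add: U_set_eq U_sym0_eq_quasi_inverse)
    show "reflection_space (U_set V a) (U_sym V a)"
      by (rule reflection_space_U)
    show "0 \<in> U_set V a"
      by (simp add: U_set_eq base_unit)
    show "U_sym V a 0 z = U_sym0 V a z" for z
      by (simp add: U_sym_def q_zero)
    \<comment> \<open>The symmetry at 0 is inversion, and the symmetry at \<open>x\<close> inverts
      once more before applying \<open>q x\<close>; the two inversions cancel.\<close>
    show "quadratic_map (U_sym V a) 0 x z = U_quad V a x z" if "z \<in> U_set V a" for x z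
      using that
      by (simp add: U_set_eq quadratic_map_def U_sym_eq q_zero inverse_unit inverse_inverse)
    show "has_algebraic_differential (U_set (dual_extension V) (Dual a 0))
        (U_sym (dual_extension V) (Dual a 0) (Dual x 0)) (U_sym V a x) x (\<lambda>v. - v)"
      if "x \<in> U_set V a" for x
      using that by (rule algebraic_differential)
    show "symmetric_space (U_set V a) (U_sym V a)
        (U_set (dual_extension V) (Dual a 0)) (U_sym (dual_extension V) (Dual a 0))"
      by (simp add: symmetric_space_def reflection_space_U algebraic_differential)
  qed
qed

end
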